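(* Let $G=(V,E)$ be a temporal graph with $m=|E|$ given as a stream $\tau$ of temporal edges in strictly increasing timestamp order, let $\delta>0$, and assume there is a constant $C_0$ with $|\mathcal{T}_i|=C_0|\mathcal{T}_j|$ for all $i,j\in[8]$. Consider STEP run with the (perfect) ranking predictor $\mathcal{O}_K$ classifying as heavy $K=o(m_\delta)$ edges, and let $\varepsilon>0$. There exist constants $C>1$ and $\gamma\in(0,\tfrac12)$ such that if for all $i\in[8]$ it holds $p\ge \frac{C\sqrt{m_\delta}}{\varepsilon|\mathcal{T}_i|^{1/2-\gamma}}$, then STEP with predictor $\mathcal{O}_K$ is a one-pass streaming algorithm with $\Pr[\exists i\in[8]: |c_i-|\mathcal{T}_i||\ge\varepsilon|\mathcal{T}_i|]\le 1/3$, using $O\!\left(\varepsilon^{-1}m_\delta^{3/2}/|\mathcal{T}_i|^{1/2-\gamma}\right)$ memory in expectation.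
   Context: A temporal graph is $G=(V,E)$ with directed temporal edges $(u,v,t)$, $u\neq v$, $t\in\mathbb{R}^+$. A temporal triangle is a directed 3-vertex, 3-edge triangle together with an ordering $\sigma$ of its edges; there are eight, $T_1,\dots,T_8$. A sequence $\langle (u_1,v_1,t_1),(u_2,v_2,t_2),(u_3,v_3,t_3)\rangle$ of edges of $E$ with $t_1<t_2<t_3$ is a $\delta$-instance of $T$ (whose $\sigma$-ordered edges are $(x_j,y_j)$) if a vertex bijection $f$ has $f(u_j)=x_j,f(v_j)=y_j$ for $j=1,2,3$ and $t_3-t_1\le\delta$. $\mathcal{T}_i$ is the set of $\delta$-instances of $T_i$. $m_\delta$ is the maximum number of edges of $\tau$ occurring in any time window of length $\delta$. Algorithm STEP (input stream $\tau$, $\delta$, predictor $\mathcal{O}:E\to\{0,1\}$, $p\in(0,1]$): keep sets $H,S_L$ (initially empty) and counters $c_{i,0},c_{i,1},c_{i,2}$ (initially 0). For each $e=(u,v,t)$ in stream order: remove stored edges with timestamp $<t-\delta$; for each pair of stored edges in $H\cup S_L$ forming with $e$ (as last edge) a $\delta$-instance of $T_i$, increment $c_{i,0}$, $c_{i,1}$ or $c_{i,2}$ according as 0, 1 or 2 of the pair lie in $H$; then if $\mathcal{O}(e)=1$ add $e$ to $H$, else add $e$ to $S_L$ independently with probability $p$. Output $c_i=c_{i,0}/p^2+c_{i,1}/p+c_{i,2}$. Ranking predictor: for $e\in E$ let $W(e)$ be the total number of $\delta$-instances (over all eight types) containing $e$; order $E$ by non-increasing $W$ (ties broken arbitrarily).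 $\mathcal{O}_K(e)=1$ iff $e$ is among the first $K$ edges of this ordering.
   Formalization: The memory bound is proved for p of the order of its lower limit, as O(K + bound), and as O(bound) when K = O(bound); without this it fails (p = 1, or K = 1 with bound tending to 0). Memory is the maximum over time of the expected number of stored edges. *)

theory Defs
  imports "HOL-Probability.Probability" "HOL-Library.Landau_Symbols"
begin

section \<open>Temporal graphs and streams\<close>

type_synonym 'v tedge = "'v \<times> 'v \<times> real"

definition ends :: "'v tedge \<Rightarrow> 'v \<times> 'v" where
  "ends = (\<lambda>(u, v, t). (u, v))"

definition time :: "'v tedge \<Rightarrow> real" where
  "time = (\<lambda>(u, v, t). t)"

definition temporal_graph :: "'v set \<Rightarrow> 'v tedge set \<Rightarrow> bool" where
  "temporal_graph V E \<longleftrightarrow> finite V \<and> finite E \<and>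
     (\<forall>(u, v, t) \<in> E. u \<in> V \<and> v \<in> V \<and> u \<noteq> v \<and> t > 0)"

definition stream_of :: "'v tedge list \<Rightarrow> 'v tedge set \<Rightarrow> bool" where
  "stream_of \<tau> E \<longleftrightarrow> set \<tau> = E \<and> sorted_wrt (<) (map time \<tau>)"

text \<open>Windows are closed intervals, in accordance with the condition
  \<open>t\<^sub>3 - t\<^sub>1 \<le> \<delta>\<close> on instances.\<close>

definition m_delta :: "'v tedge list \<Rightarrow> real \<Rightarrow> nat" where
  "m_delta \<tau> \<delta> = Max (range (\<lambda>s. card {e \<in> set \<tau>. s \<le> time e \<and> time e \<le> s + \<delta>}))"

section \<open>Temporal triangles and their instances\<close>

definition verts :: "('a \<times> 'a) list \<Rightarrow> 'a set" where
  "verts es = fst ` set es \<union> snd ` set es"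

definition iso_edges :: "('a \<times> 'a) list \<Rightarrow> ('b \<times> 'b) list \<Rightarrow> bool" where
  "iso_edges es xs \<longleftrightarrow>
     (\<exists>f. bij_betw f (verts es) (verts xs) \<and> map (map_prod f f) es = xs)"

text \<open>A temporal triangle is the list of its edges in the order \<open>\<sigma>\<close>.\<close>

definition temporal_triangle :: "('a \<times> 'a) list \<Rightarrow> bool" where
  "temporal_triangle xs \<longleftrightarrow> length xs = 3 \<and> card (verts xs) = 3 \<and> (\<forall>(a, b) \<in> set xs. a \<noteq> b) \<and>
     card ((\<lambda>(a, b). {a, b}) ` set xs) = 3"

text \<open>Up to isomorphism the first
  edge is \<open>(0, 1)\<close>; the second one joins 2 to 0 or to 1, and the third joins the remaining pair,
  which leaves two orientations for each of them. The numbering of the eight types is immaterial.\<close>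

definition tri :: "nat \<Rightarrow> (nat \<times> nat) list" where
  "tri i =
    [[(0,1), (1,2), (2,0)],
     [(0,1), (1,2), (0,2)],
     [(0,1), (2,1), (2,0)],
     [(0,1), (2,1), (0,2)],
     [(0,1), (2,0), (1,2)],
     [(0,1), (2,0), (2,1)],
     [(0,1), (0,2), (1,2)],
     [(0,1), (0,2), (2,1)]] ! (i - 1)"

lemma types_eq: "{1..8::nat} = {1,2,3,4,5,6,7,8}" by auto

lemma tri_temporal_triangle:
  assumes "i \<in> {1..8}" shows "temporal_triangle (tri i)"
  using assms unfolding types_eq
  by (auto simp: temporal_triangle_def tri_def verts_def card_insert_if doubleton_eq_iff insert_commute)

lemma tri_inj: "inj_on tri {1..8}"
  unfolding types_eq by (simp add: tri_def)

lemma verts_tri: assumes "i \<in> {1..8}" shows "verts (tri i) = {0,1,2}"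
  using assms unfolding types_eq by (auto simp: tri_def verts_def)

lemma tri_hd: assumes "i \<in> {1..8}" shows "\<exists>x y. tri i = [(0,1),x,y]"
  using assms unfolding types_eq by (auto simp: tri_def)

text \<open>So \<open>tri\<close> lists each of the eight temporal triangles exactly once up to isomorphism.\<close>

lemma tri_complete:
  assumes "temporal_triangle xs"
  shows "\<exists>!i. i \<in> {1..8} \<and> iso_edges xs (tri i)"
proof -
  obtain a b p q r s where xs: "xs = [(a,b),(p,q),(r,s)]"
    using assms unfolding temporal_triangle_def
    by (auto simp: length_Suc_conv numeral_3_eq_3)
  have ab: "a \<noteq> b" "p \<noteq> q" "r \<noteq> s" using assms by (auto simp: xs temporal_triangle_def)
  have c3: "card (verts xs) = 3" using assms by (simp add: temporal_triangle_def)
  have "\<not> verts xs \<subseteq> {a,b}"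
    using card_mono[of "{a,b}" "verts xs"] c3 ab by auto
  then obtain c where c: "c \<in> verts xs" "c \<noteq> a" "c \<noteq> b" by blast
  have sub: "{a,b,c} \<subseteq> verts xs" using c by (auto simp: xs verts_def)
  have "card {a,b,c} = 3" using ab c by simp
  moreover have "finite (verts xs)" by (simp add: verts_def)
  ultimately have v: "verts xs = {a,b,c}" using sub c3 by (metis card_subset_eq)
  have pq: "{p,q} \<noteq> {a,b}" "{r,s} \<noteq> {a,b}" "{p,q} \<noteq> {r,s}"
    using assms by (auto simp: xs temporal_triangle_def card_insert_if split: if_splits)
  have mem: "p \<in> {a,b,c}" "q \<in> {a,b,c}" "r \<in> {a,b,c}" "s \<in> {a,b,c}"
    using v by (auto simp: xs verts_def)
  define f where "f = (\<lambda>x. if x = a then 0 else if x = b then 1 else (2::nat))"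
  have bij: "bij_betw f (verts xs) {0,1,2}"
    unfolding v bij_betw_def using ab c by (auto simp: f_def inj_on_def)
  have "\<exists>i \<in> {1..8}. map (map_prod f f) xs = tri i"
  proof -
    have "{p,q} = {a,c} \<or> {p,q} = {b,c}" using mem(1,2) ab(2) pq(1) by auto
    moreover have "{r,s} = {a,c} \<or> {r,s} = {b,c}" using mem(3,4) ab(3) pq(2) by auto
    ultimately have pqrs: "{p,q} = {a,c} \<and> {r,s} = {b,c} \<or> {p,q} = {b,c} \<and> {r,s} = {a,c}"
      using pq(3) by argo
    have f: "f a = 0" "f b = 1" "f c = 2" using ab(1) c(2,3) by (auto simp: f_def)
    have m: "map (map_prod f f) xs = [(0,1), (f p, f q), (f r, f s)]" by (simp add: xs f)
    have "(f p, f q) \<in> {(0,2),(2,0)} \<and> (f r, f s) \<in> {(1,2),(2,1)} \<or>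
          (f p, f q) \<in> {(1,2),(2,1)} \<and> (f r, f s) \<in> {(0,2),(2,0)}"
      using pqrs by (auto simp: doubleton_eq_iff f)
    then show ?thesis unfolding m types_eq by (auto simp: tri_def)
  qed
  then obtain i where i: "i \<in> {1..8}" "map (map_prod f f) xs = tri i" by blast
  have "iso_edges xs (tri i)" using bij i verts_tri[OF i(1)] unfolding iso_edges_def by metis
  moreover have "j = i" if j: "j \<in> {1..8}" "iso_edges xs (tri j)" for j
  proof -
    obtain g where g: "bij_betw g (verts xs) {0,1,2}" "map (map_prod g g) xs = tri j"
      using j verts_tri[OF j(1)] unfolding iso_edges_def by metis
    have g01: "g a = 0" "g b = 1" using g(2) tri_hd[OF j(1)] by (auto simp: xs)
    have "g c \<noteq> g a" "g c \<noteq> g b"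
      using inj_onD[OF bij_betw_imp_inj_on[OF g(1)], of c a]
        inj_onD[OF bij_betw_imp_inj_on[OF g(1)], of c b] c(2,3) v by blast+
    moreover have "g c \<in> {0,1,2}" using bij_betwE[OF g(1)] c(1) by blast
    ultimately have "g c = 2" using g01 by auto
    then have "g x = f x" if "x \<in> {a,b,c}" for x using that g01 ab c by (auto simp: f_def)
    then have "map (map_prod g g) xs = map (map_prod f f) xs"
      using mem by (auto simp: xs)
    then show ?thesis using g(2) i j tri_inj by (metis inj_onD)
  qed
  ultimately show ?thesis using i(1) by blast
qed

definition is_instance :: "real \<Rightarrow> nat \<Rightarrow> 'v tedge list \<Rightarrow> bool" where
  "is_instance \<delta> i s \<longleftrightarrow> sorted_wrt (<) (map time s) \<and>
     iso_edges (map ends s) (tri i) \<and> time (last s) - time (hd s) \<le> \<delta>"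

definition instances :: "'v tedge set \<Rightarrow> real \<Rightarrow> nat \<Rightarrow> 'v tedge list set" where
  "instances E \<delta> i = {s. set s \<subseteq> E \<and> is_instance \<delta> i s}"

section \<open>The ranking predictor\<close>

definition weight :: "'v tedge set \<Rightarrow> real \<Rightarrow> 'v tedge \<Rightarrow> nat" where
  "weight E \<delta> e = (\<Sum>i = 1..8. card {s \<in> instances E \<delta> i. e \<in> set s})"

text \<open>The order \<open>es\<close> is not determined by the weights: a ranking predictor may come from any way of
  breaking ties. If \<open>K\<close> exceeds the number of edges, all of them are heavy.\<close>

definition ranking_predictor ::
  "'v tedge set \<Rightarrow> real \<Rightarrow> nat \<Rightarrow> ('v tedge \<Rightarrow> bool) \<Rightarrow> bool" where
  "ranking_predictor E \<delta> K pred \<longleftrightarrow>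
     (\<exists>es. distinct es \<and> set es = E \<and> sorted_wrt (\<lambda>a b. weight E \<delta> a \<ge> weight E \<delta> b) es \<and>
           (\<forall>e \<in> E. pred e \<longleftrightarrow> e \<in> set (take K es)))"

section \<open>The algorithm STEP\<close>

text \<open>\<open>counter st i j\<close> is the number of counted instances of type \<open>i\<close> whose first two edges
  comprise exactly \<open>j\<close> heavy ones.\<close>

record 'v step_state =
  heavy :: "'v tedge set"
  light :: "'v tedge set"
  counter :: "nat \<Rightarrow> nat \<Rightarrow> nat"

definition init_state :: "'v step_state" where
  "init_state = \<lparr>heavy = {}, light = {}, counter = (\<lambda>i j. 0)\<rparr>"

text \<open>A pair of stored edges is taken in chronological order, the only one in which it can be part
  of an instance.\<close>

definition process_edge ::
  "real \<Rightarrow> ('v tedge \<Rightarrow> bool) \<Rightarrow> real \<Rightarrow> 'v tedge \<Rightarrow> 'v step_state \<Rightarrow> 'v step_state pmf" where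
  "process_edge \<delta> pred p e st =
    (let H = {a \<in> heavy st. time a \<ge> time e - \<delta>};
         S = {a \<in> light st. time a \<ge> time e - \<delta>};
         c = (\<lambda>i j. counter st i j +
                card {(a, b). a \<in> H \<union> S \<and> b \<in> H \<union> S \<and> is_instance \<delta> i [a, b, e] \<and>
                              card ({a, b} \<inter> H) = j})
     in if pred e then return_pmf \<lparr>heavy = insert e H, light = S, counter = c\<rparr>
        else map_pmf (\<lambda>keep. \<lparr>heavy = H, light = (if keep then insert e S else S), counter = c\<rparr>)
               (bernoulli_pmf p))"

fun run_step ::
  "real \<Rightarrow> ('v tedge \<Rightarrow> bool) \<Rightarrow> real \<Rightarrow> 'v tedge list \<Rightarrow> 'v step_state \<Rightarrow> 'v step_state pmf" where
  "run_step \<delta> pred p [] st = return_pmf st"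
| "run_step \<delta> pred p (e # es) st = bind_pmf (process_edge \<delta> pred p e st) (run_step \<delta> pred p es)"

definition STEP ::
  "'v tedge list \<Rightarrow> real \<Rightarrow> ('v tedge \<Rightarrow> bool) \<Rightarrow> real \<Rightarrow> 'v step_state pmf" where
  "STEP \<tau> \<delta> pred p = run_step \<delta> pred p \<tau> init_state"

definition estimate :: "real \<Rightarrow> 'v step_state \<Rightarrow> nat \<Rightarrow> real" where
  "estimate p st i = counter st i 0 / p\<^sup>2 + counter st i 1 / p + counter st i 2"

text \<open>Memory is the number of stored edges; the constantly many counters are not charged. The
  expected memory is the largest expectation over all moments of the pass, not the
  expectation of the maximum.\<close>

definition expected_memory :: "'v tedge list \<Rightarrow> real \<Rightarrow> ('v tedge \<Rightarrow> bool) \<Rightarrow> real \<Rightarrow> real" where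
  "expected_memory \<tau> \<delta> pred p =
     Max ((\<lambda>k. measure_pmf.expectation (STEP (take k \<tau>) \<delta> pred p)
                 (\<lambda>st. real (card (heavy st \<union> light st)))) ` {..length \<tau>})"

end

theory Submission
  imports Defs
begin

text \<open>
  With the coins tossed in advance, the output of STEP is the inverse probability estimator
  \<open>c\<^sub>i = \<Sum> Y\<^sub>a Y\<^sub>b\<close> over the instances \<open>(a, b, e)\<close> of type \<open>i\<close>, where the \<open>Y\<^sub>a\<close> are independent
  with mean 1 and second moment at most \<open>1/p\<close>. Two instances contribute to the variance only if
  their first two edges overlap: at most \<open>1/p\<^sup>2\<close> if both edges agree, and at most \<open>1/p\<close> otherwise.
  An instance agrees in both edges with at most \<open>m\<close> others, \<open>m = m\<^sub>\<delta>\<close>, and overlaps with at most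
  \<open>min (4m\<^sup>2) T \<le> 2m \<surd>T\<close> others. So the variance is at most \<open>2 m T\<^bsup>3/2\<^esup>/p + m T/p\<^sup>2\<close>, whatever the
  predictor is. For \<open>\<gamma> = 1/4\<close> the bound on \<open>p\<close>, combined with \<open>p \<le> 1\<close>, makes this at most
  \<open>3 (\<epsilon> T / C)\<^sup>2\<close>; Chebyshev's inequality and a union bound over the eight types finish with \<open>C = 9\<close>.
  The memory consists of at most \<open>K\<close> heavy edges and the light ones sampled from a single window.
\<close>

section \<open>STEP as a function of independent coins\<close>

text \<open>The coin \<open>k\<close> is supplied for a heavy edge too and then ignored. Thus every
  edge owns one coin, and the randomness of a whole run is a product over all edges.\<close>

definition coin_step ::
  "real \<Rightarrow> ('v tedge \<Rightarrow> bool) \<Rightarrow> bool \<Rightarrow> 'v tedge \<Rightarrow> 'v step_state \<Rightarrow> 'v step_state" where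
  "coin_step \<delta> pred k e st =
    (let H = {a \<in> heavy st. time a \<ge> time e - \<delta>};
         S = {a \<in> light st. time a \<ge> time e - \<delta>};
         c = (\<lambda>i j. counter st i j +
                card {(a, b). a \<in> H \<union> S \<and> b \<in> H \<union> S \<and> is_instance \<delta> i [a, b, e] \<and>
                              card ({a, b} \<inter> H) = j})
     in if pred e then \<lparr>heavy = insert e H, light = S, counter = c\<rparr>
        else \<lparr>heavy = H, light = (if k then insert e S else S), counter = c\<rparr>)"

definition coin_run ::
  "real \<Rightarrow> ('v tedge \<Rightarrow> bool) \<Rightarrow> ('v tedge \<Rightarrow> bool) \<Rightarrow> 'v tedge list \<Rightarrow> 'v step_state \<Rightarrow> 'v step_state"
where
  "coin_run \<delta> pred X es = fold (\<lambda>e. coin_step \<delta> pred (X e) e) es"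

abbreviation coins :: "'v tedge set \<Rightarrow> real \<Rightarrow> ('v tedge \<Rightarrow> bool) pmf" where
  "coins E p \<equiv> Pi_pmf E False (\<lambda>_. bernoulli_pmf p)"

lemma process_edge_eq:
  "process_edge \<delta> pred p e st = map_pmf (\<lambda>k. coin_step \<delta> pred k e st) (bernoulli_pmf p)"
  by (simp add: process_edge_def coin_step_def Let_def map_pmf_const)

text \<open>Distinctness guarantees that each coin is read once: \<open>Pi_pmf_insert\<close> splits
  off the coin of the first edge, and altering that coordinate does not affect the run on the
  remaining edges.\<close>

lemma run_step_eq:
  assumes "distinct es"
  shows "run_step \<delta> pred p es st = map_pmf (\<lambda>X. coin_run \<delta> pred X es st) (coins (set es) p)"
  using assms
proof (induction es arbitrary: st)
  case Nil
  then show ?case by (simp add: coin_run_def)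
next
  case (Cons e es)
  have *: "coin_run \<delta> pred (X(e := k)) es st' = coin_run \<delta> pred X es st'" for X k st'
    unfolding coin_run_def by (rule fold_cong) (use Cons.prems in auto)
  have "run_step \<delta> pred p (e # es) st =
      bind_pmf (bernoulli_pmf p) (\<lambda>k. map_pmf (\<lambda>X. coin_run \<delta> pred X es (coin_step \<delta> pred k e st))
        (coins (set es) p))"
    using Cons by (simp add: process_edge_eq bind_map_pmf)
  also have "\<dots> = map_pmf (\<lambda>X. coin_run \<delta> pred X (e # es) st) (coins (set (e # es)) p)"
    using Cons.prems * unfolding list.set
    by (subst Pi_pmf_insert)
       (simp_all add: pair_pmf_def map_bind_pmf map_pmf_def[symmetric] pmf.map_comp o_def
          coin_run_def bind_return_pmf bind_assoc_pmf bind_map_pmf flip: map_pmf_def)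
  finally show ?case .
qed

section \<open>Instances as ordered triples, and the state in closed form\<close>

definition triples :: "'v tedge set \<Rightarrow> real \<Rightarrow> nat \<Rightarrow> ('v tedge \<times> 'v tedge \<times> 'v tedge) set" where
  "triples E \<delta> i = {(a, b, e). a \<in> E \<and> b \<in> E \<and> e \<in> E \<and> is_instance \<delta> i [a, b, e]}"

lemma is_instance_times:
  "is_instance \<delta> i [a, b, e] \<Longrightarrow> time a < time b \<and> time b < time e \<and> time e - time a \<le> \<delta>"
  by (simp add: is_instance_def)

lemma finite_triples: "finite E \<Longrightarrow> finite (triples E \<delta> i)"
  by (rule finite_subset[of _ "E \<times> E \<times> E"]) (auto simp: triples_def)

text \<open>An instance is mapped edge by edge onto \<open>tri i\<close>, so it has exactly three
  entries.\<close>

lemma instances_eq_image: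
  assumes "i \<in> {1..8}"
  shows "instances E \<delta> i = (\<lambda>(a, b, e). [a, b, e]) ` triples E \<delta> i"
proof (intro equalityI subsetI)
  fix s assume s: "s \<in> instances E \<delta> i"
  then obtain f :: "'a \<Rightarrow> nat" where "map (map_prod f f) (map ends s) = tri i"
    unfolding instances_def is_instance_def iso_edges_def by blast
  then have "length s = length (tri i)"
    by (metis length_map)
  also have "\<dots> = 3"
    using tri_temporal_triangle[OF assms] by (simp add: temporal_triangle_def)
  finally obtain a b e where abe: "s = [a, b, e]"
    by (auto simp: length_Suc_conv numeral_3_eq_3)
  then have "(a, b, e) \<in> triples E \<delta> i"
    using s by (simp add: instances_def triples_def)
  then show "s \<in> (\<lambda>(a, b, e). [a, b, e]) ` triples E \<delta> i"
    by (rule rev_image_eqI) (simp add: abe)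
next
  fix s assume "s \<in> (\<lambda>(a, b, e). [a, b, e]) ` triples E \<delta> i"
  then obtain t where t: "s = (case t of (a, b, e) \<Rightarrow> [a, b, e])" "t \<in> triples E \<delta> i"
    by blast
  then obtain a b e where "s = [a, b, e]" "(a, b, e) \<in> triples E \<delta> i"
    by (cases t) simp
  then show "s \<in> instances E \<delta> i"
    by (simp add: instances_def triples_def)
qed

lemma card_instances:
  assumes "i \<in> {1..8}"
  shows "card (instances E \<delta> i) = card (triples E \<delta> i)"
  unfolding instances_eq_image[OF assms] by (rule card_image) (auto simp: inj_on_def)

text \<open>Invariant of the pass for a fixed outcome \<open>X\<close>. Because times increase, a
  removed edge is too old for every later instance, so the counters see each instance whose first
  two edges were ever stored. For the empty stream the unspecified \<open>last es\<close> is
  harmless, as both sets are empty.\<close>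

lemma coin_run_eq:
  assumes "sorted_wrt (<) (map time es)" "\<delta> > 0"
  shows "coin_run \<delta> pred X es init_state =
    \<lparr>heavy = {a \<in> set es. pred a \<and> time (last es) - \<delta> \<le> time a},
     light = {a \<in> set es. \<not> pred a \<and> X a \<and> time (last es) - \<delta> \<le> time a},
     counter = (\<lambda>i j. card {(a, b, e). (a, b, e) \<in> triples (set es) \<delta> i \<and> (pred a \<or> X a) \<and>
       (pred b \<or> X b) \<and> card ({a, b} \<inter> Collect pred) = j})\<rparr>"
  using assms(1)
proof (induction es rule: rev_induct)
  case Nil
  then show ?case by (simp add: coin_run_def init_state_def triples_def)
next
  case (snoc e es)
  have late: "time a < time e" if "a \<in> set es" for a
    using snoc.prems that by (auto simp: sorted_wrt_append)
  then have last: "es \<noteq> [] \<Longrightarrow> time (last es) < time e" by simp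
  define R where "R = {a \<in> set es. time e - \<delta> \<le> time a}"
  define H where "H = {a \<in> R. pred a}"
  define S where "S = {a \<in> R. \<not> pred a \<and> X a}"
  define st where "st = coin_run \<delta> pred X es init_state"
  have IH: "st = \<lparr>heavy = {a \<in> set es. pred a \<and> time (last es) - \<delta> \<le> time a},
     light = {a \<in> set es. \<not> pred a \<and> X a \<and> time (last es) - \<delta> \<le> time a},
     counter = (\<lambda>i j. card {(a, b, e). (a, b, e) \<in> triples (set es) \<delta> i \<and> (pred a \<or> X a) \<and>
       (pred b \<or> X b) \<and> card ({a, b} \<inter> Collect pred) = j})\<rparr>"
    using snoc by (simp add: sorted_wrt_append st_def)
  \<comment> \<open>The cutoff only moves forward, so filtering the survivors of the previous cutoff
    agrees with filtering the whole prefix by the new one.\<close>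
  have H: "{a \<in> heavy st. time a \<ge> time e - \<delta>} = H"
    using last by (force simp: IH H_def R_def)
  have S: "{a \<in> light st. time a \<ge> time e - \<delta>} = S"
    using last by (force simp: IH S_def R_def)
  have run: "coin_run \<delta> pred X (es @ [e]) init_state = coin_step \<delta> pred (X e) e st"
    by (simp add: coin_run_def st_def)
  have cnt: "counter st i j + card {(a, b). a \<in> H \<union> S \<and> b \<in> H \<union> S \<and> is_instance \<delta> i [a, b, e] \<and>
                              card ({a, b} \<inter> H) = j} =
      card {(a, b, e'). (a, b, e') \<in> triples (set (es @ [e])) \<delta> i \<and> (pred a \<or> X a) \<and>
       (pred b \<or> X b) \<and> card ({a, b} \<inter> Collect pred) = j}" (is "_ + card ?P = card ?N") for i j
  proof -
    let ?O = "{(a, b, e). (a, b, e) \<in> triples (set es) \<delta> i \<and> (pred a \<or> X a) \<and>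
       (pred b \<or> X b) \<and> card ({a, b} \<inter> Collect pred) = j}"
    have same: "{a, b} \<inter> H = {a, b} \<inter> Collect pred" if "a \<in> H \<union> S" "b \<in> H \<union> S" for a b
      using that by (auto simp: H_def S_def)
    have HS: "a \<in> H \<union> S \<longleftrightarrow> a \<in> R \<and> (pred a \<or> X a)" for a
      by (auto simp: H_def S_def)
    \<comment> \<open>The span condition of an instance ending in \<open>e\<close> already forces
      both earlier edges into the window of \<open>e\<close>.\<close>
    have R: "a \<in> set (es @ [e]) \<and> b \<in> set (es @ [e]) \<longleftrightarrow> a \<in> R \<and> b \<in> R"
      if "is_instance \<delta> i [a, b, e]" for a b
      using is_instance_times[OF that] by (auto simp: R_def)
    \<comment> \<open>The edge \<open>e\<close> is the latest one, so it can only be the last edge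
      of an instance: every triple is either old or ends in \<open>e\<close>.\<close>
    have split: "?N = ?O \<union> (\<lambda>(a, b). (a, b, e)) ` ?P"
    proof (intro set_eqI)
      fix t :: "'a tedge \<times> 'a tedge \<times> 'a tedge"
      obtain a b e' where t: "t = (a, b, e')" by (cases t)
      show "t \<in> ?N \<longleftrightarrow> t \<in> ?O \<union> (\<lambda>(a, b). (a, b, e)) ` ?P"
      proof (cases "e' = e")
        case True
        have "e \<notin> set es" using late by blast
        then have "t \<notin> ?O" by (simp add: t True triples_def)
        moreover have "t \<in> (\<lambda>(a, b). (a, b, e)) ` ?P \<longleftrightarrow> (a, b) \<in> ?P"
          by (auto simp: t True)
        moreover have "(a, b) \<in> ?P \<longleftrightarrow> t \<in> ?N"
        proof (cases "is_instance \<delta> i [a, b, e]")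
          case inst: True
          have "(a, b) \<in> ?P \<longleftrightarrow> a \<in> H \<union> S \<and> b \<in> H \<union> S \<and> card ({a, b} \<inter> Collect pred) = j"
            using same[of a b] inst by auto
          also have "\<dots> \<longleftrightarrow> t \<in> ?N"
            using R[OF inst] inst unfolding HS t True triples_def by auto
          finally show ?thesis .
        qed (simp add: t True triples_def)
        ultimately show ?thesis unfolding Un_iff by argo
      next
        case False
        have "a \<noteq> e \<and> b \<noteq> e" if "(a, b, e') \<in> triples (set (es @ [e])) \<delta> i"
          using that False late[of e'] is_instance_times[of \<delta> i a b e'] by (auto simp: triples_def)
        then have "(a, b, e') \<in> triples (set (es @ [e])) \<delta> i \<longleftrightarrow> (a, b, e') \<in> triples (set es) \<delta> i"
          using False unfolding triples_def by auto
        then show ?thesis using False by (auto simp: t)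
      qed
    qed
    have "e \<notin> set es" using late by blast
    then have "?O \<inter> (\<lambda>(a, b). (a, b, e)) ` ?P = {}"
      by (auto simp: triples_def)
    moreover have "finite ?O"
      by (rule finite_subset[OF _ finite_triples[of "set es" \<delta> i]]) auto
    moreover have "finite ?P"
      by (rule finite_subset[of _ "set es \<times> set es"]) (auto simp: H_def S_def R_def)
    ultimately have "card ?N = card ?O + card ((\<lambda>(a, b). (a, b, e)) ` ?P)"
      unfolding split by (intro card_Un_disjoint) auto
    also have "card ((\<lambda>(a, b). (a, b, e)) ` ?P) = card ?P"
      by (rule card_image) (auto simp: inj_on_def)
    finally show ?thesis by (simp add: IH)
  qed
  have "coin_run \<delta> pred X (es @ [e]) init_state =
    \<lparr>heavy = (if pred e then insert e H else H), light = (if \<not> pred e \<and> X e then insert e S else S),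
     counter = (\<lambda>i j. card {(a, b, e'). (a, b, e') \<in> triples (set (es @ [e])) \<delta> i \<and> (pred a \<or> X a) \<and>
       (pred b \<or> X b) \<and> card ({a, b} \<inter> Collect pred) = j})\<rparr>"
    unfolding run coin_step_def Let_def H S cnt by simp
  \<comment> \<open>Positivity of \<delta> puts the new edge inside the window that ends with
    it.\<close>
  moreover have "(if pred e then insert e H else H) =
      {a \<in> set (es @ [e]). pred a \<and> time (last (es @ [e])) - \<delta> \<le> time a}"
    using \<open>\<delta> > 0\<close> by (auto simp: H_def R_def)
  moreover have "(if \<not> pred e \<and> X e then insert e S else S) =
      {a \<in> set (es @ [e]). \<not> pred a \<and> X a \<and> time (last (es @ [e])) - \<delta> \<le> time a}"
    using \<open>\<delta> > 0\<close> by (auto simp: S_def R_def)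
  ultimately show ?case by simp
qed

section \<open>Moments of the estimator\<close>

text \<open>The Horvitz-Thompson weight: a stored edge counts with the inverse of its storage
  probability, which is 1 for heavy and \<open>p\<close> for light edges.\<close>

definition inv_prob_weight :: "('v tedge \<Rightarrow> bool) \<Rightarrow> real \<Rightarrow> ('v tedge \<Rightarrow> bool) \<Rightarrow> 'v tedge \<Rightarrow> real" where
  "inv_prob_weight pred p X a = (if pred a then 1 else of_bool (X a) / p)"

text \<open>A triple with \<open>j\<close> heavy edges among its first two depends on
  \<open>2 - j\<close> coins. The scalings of the three counters are therefore exactly the products
  of the two weights.\<close>

lemma estimate_coin_run:
  assumes "sorted_wrt (<) (map time es)" "\<delta> > 0" "p > 0"
  shows "estimate p (coin_run \<delta> pred X es init_state) i =
    (\<Sum>(a, b, e) \<in> triples (set es) \<delta> i. inv_prob_weight pred p X a * inv_prob_weight pred p X b)"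
proof -
  let ?T = "triples (set es) \<delta> i"
  define Q :: "nat \<Rightarrow> 'a tedge \<times> 'a tedge \<times> 'a tedge \<Rightarrow> bool" where
    "Q j = (\<lambda>(a, b, e). (pred a \<or> X a) \<and> (pred b \<or> X b) \<and> card ({a, b} \<inter> Collect pred) = j)" for j
  have fin: "finite ?T" by (simp add: finite_triples)
  have cnt: "real (counter (coin_run \<delta> pred X es init_state) i j) = (\<Sum>t \<in> ?T. of_bool (Q j t))" for j
  proof -
    have "{(a, b, e). (a, b, e) \<in> ?T \<and> (pred a \<or> X a) \<and> (pred b \<or> X b) \<and>
        card ({a, b} \<inter> Collect pred) = j} = ?T \<inter> Collect (Q j)"
      unfolding Q_def by blast
    then show ?thesis
      unfolding coin_run_eq[OF assms(1,2)] by (simp add: fin)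
  qed
  have "of_bool (Q 0 t) / p\<^sup>2 + of_bool (Q 1 t) / p + of_bool (Q 2 t) =
      (case t of (a, b, e) \<Rightarrow> inv_prob_weight pred p X a * inv_prob_weight pred p X b)"
    if "t \<in> ?T" for t
  proof -
    obtain a b e where t: "t = (a, b, e)" by (cases t)
    have "a \<noteq> b" using that is_instance_times[of \<delta> i a b e] by (auto simp: t triples_def)
    then show ?thesis
      by (cases "pred a"; cases "pred b")
         (auto simp: t Q_def inv_prob_weight_def power2_eq_square Int_insert_left)
  qed
  then show ?thesis
    unfolding estimate_def cnt sum_divide_distrib sum.distrib[symmetric] by (intro sum.cong) auto
qed

section \<open>Mixed moments of the independent weights\<close>

lemma finite_set_coins: "finite E \<Longrightarrow> finite (set_pmf (coins E p))"
  by (simp add: set_Pi_pmf finite_PiE_dflt)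

lemma integrable_coins [simp]:
  "finite E \<Longrightarrow> integrable (measure_pmf (coins E p)) (f :: _ \<Rightarrow> real)"
  by (intro integrable_measure_pmf_finite finite_set_coins)

text \<open>Independence factors the expectation over the edges. A heavy weight is constantly 1, and
  for \<open>k > 0\<close> the \<open>k\<close>-th moment of a light one is
  \<open>p / p ^ k\<close>. The exponents \<open>k x\<close> cover all mixed moments at
  once.\<close>

lemma expectation_prod_weights:
  assumes "finite E" "0 < p" "p \<le> 1"
  shows "measure_pmf.expectation (coins E p) (\<lambda>X. \<Prod>x\<in>E. inv_prob_weight pred p X x ^ k x) =
    (\<Prod>x\<in>E. if pred x \<or> k x = 0 then 1 else 1 / p ^ (k x - 1))"
proof -
  have eq: "measure_pmf.expectation (bernoulli_pmf p)
      (\<lambda>v. (if pred x then 1 else of_bool v / p) ^ k x) =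
      (if pred x \<or> k x = 0 then 1 else 1 / p ^ (k x - 1))" for x
    using assms by (cases "k x") (auto simp: power_divide)
  have "measure_pmf.expectation (coins E p)
      (\<lambda>X. \<Prod>x\<in>E. (\<lambda>x v. (if pred x then 1 else of_bool v / p) ^ k x) x (X x)) =
      (\<Prod>x\<in>E. measure_pmf.expectation (bernoulli_pmf p)
        ((\<lambda>x v. (if pred x then 1 else of_bool v / p) ^ k x) x))"
    by (rule expectation_prod_Pi_pmf)
       (use assms in \<open>auto intro!: integrable_measure_pmf_finite\<close>)
  then show ?thesis
    unfolding eq by (simp add: inv_prob_weight_def)
qed

text \<open>Turns a single weight into a product over all edges with indicator exponents, so that
  exponents add up when weights are multiplied.\<close>

lemma prod_power_of_bool:
  fixes f :: "'a \<Rightarrow> real"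
  assumes "finite E" "a \<in> E"
  shows "(\<Prod>x\<in>E. f x ^ of_bool (x = a)) = f a"
proof -
  have "(\<Prod>x\<in>E. f x ^ of_bool (x = a)) = (\<Prod>x\<in>E. if x = a then f x else 1)"
    by (intro prod.cong) auto
  then show ?thesis using assms by simp
qed

text \<open>Two distinct edges give exponents at most 1, and each weight has mean 1; this is
  unbiasedness for a single triple.\<close>

lemma expectation_two_weights:
  assumes "finite E" "0 < p" "p \<le> 1" "a \<in> E" "b \<in> E" "a \<noteq> b"
  shows "measure_pmf.expectation (coins E p)
    (\<lambda>X. inv_prob_weight pred p X a * inv_prob_weight pred p X b) = 1"
proof -
  define k :: "_ \<Rightarrow> nat" where "k x = of_bool (x = a) + of_bool (x = b)" for x
  have "inv_prob_weight pred p X a * inv_prob_weight pred p X b =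
      (\<Prod>x\<in>E. inv_prob_weight pred p X x ^ k x)" for X
    unfolding k_def power_add prod.distrib by (simp add: prod_power_of_bool assms)
  moreover have "k x = 0 \<or> k x = 1" for x
    using \<open>a \<noteq> b\<close> by (simp add: k_def)
  then have "(if pred x \<or> k x = 0 then 1 else 1 / p ^ (k x - 1)) = 1" for x
    by (metis diff_self_eq_0 div_by_1 power_0)
  ultimately show ?thesis
    by (simp only: expectation_prod_weights[OF assms(1-3)] prod.neutral_const)
qed

text \<open>Each pair consists of distinct edges, so exponent 2 arises only at an edge common to
  both pairs. It costs a factor \<open>1 / p\<close> if light and 1 if heavy; bounding both by
  \<open>1 / p\<close> frees the estimate from the predictor.\<close>

lemma expectation_four_weights:
  assumes "finite E" "0 < p" "p \<le> 1" "a \<in> E" "b \<in> E" "a \<noteq> b" "c \<in> E" "d \<in> E" "c \<noteq> d"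
  shows "measure_pmf.expectation (coins E p)
    (\<lambda>X. inv_prob_weight pred p X a * inv_prob_weight pred p X b *
      (inv_prob_weight pred p X c * inv_prob_weight pred p X d))
    \<le> (1 / p) ^ card ({a, b} \<inter> {c, d})"
proof -
  define k :: "_ \<Rightarrow> nat" where
    "k x = (of_bool (x = a) + of_bool (x = b)) + (of_bool (x = c) + of_bool (x = d))" for x
  have "inv_prob_weight pred p X a * inv_prob_weight pred p X b *
      (inv_prob_weight pred p X c * inv_prob_weight pred p X d) =
      (\<Prod>x\<in>E. inv_prob_weight pred p X x ^ k x)" for X
    unfolding k_def power_add prod.distrib by (simp add: prod_power_of_bool assms)
  then have "measure_pmf.expectation (coins E p)
    (\<lambda>X. inv_prob_weight pred p X a * inv_prob_weight pred p X b *
      (inv_prob_weight pred p X c * inv_prob_weight pred p X d)) =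
      (\<Prod>x\<in>E. if pred x \<or> k x = 0 then 1 else 1 / p ^ (k x - 1))"
    by (simp only: expectation_prod_weights[OF assms(1-3)])
  also have "\<dots> \<le> (\<Prod>x\<in>E. if x \<in> {a, b} \<inter> {c, d} then 1 / p else 1)"
  proof (intro prod_mono conjI)
    fix x
    have "k x \<le> (if x \<in> {a, b} \<inter> {c, d} then 2 else 1)"
      using assms by (auto simp: k_def)
    then have "k x = 0 \<or> k x = 1 \<or> k x = 2 \<and> x \<in> {a, b} \<inter> {c, d}"
      by (auto split: if_splits)
    then show "(if pred x \<or> k x = 0 then 1 else 1 / p ^ (k x - 1)) \<le>
        (if x \<in> {a, b} \<inter> {c, d} then 1 / p else 1)"
      using assms(2,3) by auto
  qed (use assms in auto)
  also have "\<dots> = (1 / p) ^ card (E \<inter> ({a, b} \<inter> {c, d}))"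
    using assms(1) by (simp only: prod.If_cases prod_constant Collect_mem_eq power_one mult_1_right)
  also have "E \<inter> ({a, b} \<inter> {c, d}) = {a, b} \<inter> {c, d}" using assms by blast
  finally show ?thesis .
qed

text \<open>Expanding the square yields one covariance per pair of triples. It is at most 0 for
  disjoint first pairs, \<open>1 / p\<close> for one common edge and \<open>1 / p\<^sup>2\<close>
  for two. The middle charge is levied on every overlapping pair, which only enlarges the
  bound.\<close>

lemma second_moment_estimate:
  fixes E :: "'v tedge set" and pred :: "'v tedge \<Rightarrow> bool"
  assumes "finite E" "0 < p" "p \<le> 1"
  defines "Z \<equiv> (\<lambda>X (a, b, e). inv_prob_weight pred p X a * inv_prob_weight pred p X b)"
  shows "measure_pmf.expectation (coins E p)
      (\<lambda>X. ((\<Sum>t \<in> triples E \<delta> i. Z X t) - card (triples E \<delta> i))\<^sup>2) \<le>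
    (\<Sum>(a, b, e) \<in> triples E \<delta> i.
      real (card {(c, d, f) \<in> triples E \<delta> i. {a, b} \<inter> {c, d} \<noteq> {}}) / p +
      real (card {(c, d, f) \<in> triples E \<delta> i. a = c \<and> b = d}) / p\<^sup>2)"
proof -
  let ?T = "triples E \<delta> i" and ?E = "measure_pmf.expectation (coins E p)"
  note [simp] = assms(1)
  have mem: "a \<in> E \<and> b \<in> E \<and> time a < time b \<and> a \<noteq> b" if "(a, b, e) \<in> ?T" for a b e
    using that is_instance_times[of \<delta> i a b e] by (auto simp: triples_def)
  have one: "?E (\<lambda>X. Z X t) = 1" if "t \<in> ?T" for t
    using that mem expectation_two_weights[OF assms(1-3)] unfolding Z_def by (cases t) auto
  define A where "A = (\<lambda>(a, b, e :: 'v tedge) (c, d, f :: 'v tedge). {a, b} \<inter> {c, d :: 'v tedge} \<noteq> {})"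
  define B where "B = (\<lambda>(a, b, e :: 'v tedge) (c, d, f :: 'v tedge). a = (c :: 'v tedge) \<and> b = (d :: 'v tedge))"
  have two: "?E (\<lambda>X. Z X s * Z X t) - 1 \<le> of_bool (A s t) / p + of_bool (B s t) / p\<^sup>2"
    if s: "s \<in> ?T" and t: "t \<in> ?T" for s t
  proof -
    obtain a b e c d f where st: "s = (a, b, e)" "t = (c, d, f)" by (cases s, cases t)
    have m: "a \<in> E" "b \<in> E" "a \<noteq> b" "c \<in> E" "d \<in> E" "c \<noteq> d" "time a < time b" "time c < time d"
      using mem s t by (auto simp: st)
    have "?E (\<lambda>X. Z X s * Z X t) \<le> (1 / p) ^ card ({a, b} \<inter> {c, d})"
      unfolding st Z_def case_prod_conv by (rule expectation_four_weights) (use assms m in auto)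
    moreover have "(1 / p) ^ card ({a, b} \<inter> {c, d}) - 1 \<le> of_bool (A s t) / p + of_bool (B s t) / p\<^sup>2"
    proof -
      have p: "1 / p > 0" using assms by simp
      \<comment> \<open>The crossed match \<open>a = d\<close>, \<open>b = c\<close> contradicts the
        chronological order of both pairs, so two common edges agree position by position.\<close>
      consider "{a, b} \<inter> {c, d} = {}" | "card ({a, b} \<inter> {c, d}) = 1"
        | "a = c" "b = d"
        using m by (cases "a = c"; cases "a = d"; cases "b = c"; cases "b = d")
          (simp_all add: Int_insert_left)
      then show ?thesis
      proof cases
        case 1
        then show ?thesis using assms by (auto simp: st A_def B_def)
      next
        case 2
        then have "{a, b} \<inter> {c, d} \<noteq> {}" by (metis card.empty zero_neq_one)
        then have "A s t" by (simp add: st A_def)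
        then show ?thesis using 2 p assms by (auto simp: add_increasing2)
      next
        case 3
        moreover have "- 1 \<le> 1 / p" using p by linarith
        ultimately show ?thesis using m by (simp add: st A_def B_def power2_eq_square)
      qed
    qed
    ultimately show ?thesis by linarith
  qed
  have "((\<Sum>t\<in>?T. Z X t) - card ?T)\<^sup>2 = (\<Sum>s\<in>?T. \<Sum>t\<in>?T. Z X s * Z X t - Z X s - Z X t + 1)" for X
  proof -
    have "(\<Sum>t\<in>?T. Z X t) - card ?T = (\<Sum>t\<in>?T. Z X t - 1)"
      by (simp add: sum_subtractf)
    then show ?thesis
      by (simp add: power2_eq_square sum_product algebra_simps)
  qed
  then have "?E (\<lambda>X. ((\<Sum>t\<in>?T. Z X t) - card ?T)\<^sup>2) =
      (\<Sum>s\<in>?T. \<Sum>t\<in>?T. ?E (\<lambda>X. Z X s * Z X t) - ?E (\<lambda>X. Z X s) - ?E (\<lambda>X. Z X t) + 1)"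
    by (simp add: Bochner_Integration.integral_sum)
  also have "\<dots> \<le> (\<Sum>s\<in>?T. \<Sum>t\<in>?T. of_bool (A s t) / p + of_bool (B s t) / p\<^sup>2)"
    by (intro sum_mono) (use one two in fastforce)
  also have "\<dots> = (\<Sum>s\<in>?T. real (card {t\<in>?T. A s t}) / p + real (card {t\<in>?T. B s t}) / p\<^sup>2)"
    by (simp add: sum.distrib flip: sum_divide_distrib)
       (simp add: sum_of_bool_eq finite_triples Int_def)
  also have "\<dots> = (\<Sum>(a, b, e) \<in> ?T. 
      real (card {(c, d, f) \<in> ?T. {a, b} \<inter> {c, d} \<noteq> {}}) / p +
      real (card {(c, d, f) \<in> ?T. a = c \<and> b = d}) / p\<^sup>2)"
    by (intro sum.cong refl) (auto simp: A_def B_def case_prod_unfold)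
  finally show ?thesis .
qed

section \<open>Counting overlapping instances\<close>

text \<open>There are infinitely many windows, but their sizes are bounded by
  \<open>card (set \<tau>)\<close>, so the maximum is over a finite set of numbers.\<close>

lemma card_window_le:
  "card {e \<in> set \<tau>. s \<le> time e \<and> time e \<le> s + \<delta>} \<le> m_delta \<tau> \<delta>"
  unfolding m_delta_def
proof (rule Max_ge)
  show "finite (range (\<lambda>s. card {e \<in> set \<tau>. s \<le> time e \<and> time e \<le> s + \<delta>}))"
    by (rule finite_subset[of _ "{..card (set \<tau>)}"]) (auto intro!: card_mono)
qed simp

text \<open>If \<open>x\<close> comes first, the two other edges lie in the window starting at
  \<open>x\<close>. If it comes second, the first edge lies in the window ending at \<open>x\<close>
  and the last one in the window starting there. Each case leaves at most the square of
  \<open>m_delta \<tau> \<delta>\<close> choices.\<close>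

lemma card_triples_with_edge:
  "card {(c, d, f) \<in> triples (set \<tau>) \<delta> i. x \<in> {c, d}} \<le> 2 * (m_delta \<tau> \<delta>)\<^sup>2"
proof -
  define W where "W s = {e \<in> set \<tau>. s \<le> time e \<and> time e \<le> s + \<delta>}" for s
  have W: "card (W s) \<le> m_delta \<tau> \<delta>" "finite (W s)" for s
    unfolding W_def by (rule card_window_le) simp
  let ?A = "(\<lambda>(d, f). (x, d, f)) ` (W (time x) \<times> W (time x))"
  let ?B = "(\<lambda>(c, f). (c, x, f)) ` (W (time x - \<delta>) \<times> W (time x))"
  have "t \<in> ?A \<union> ?B" if "t \<in> {(c, d, f) \<in> triples (set \<tau>) \<delta> i. x \<in> {c, d}}" for t
  proof -
    obtain c d f where t: "t = (c, d, f)" by (cases t)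
    have m: "c \<in> set \<tau>" "d \<in> set \<tau>" "f \<in> set \<tau>" "x = c \<or> x = d"
      "time c < time d \<and> time d < time f \<and> time f - time c \<le> \<delta>"
      using that is_instance_times[of \<delta> i c d f] by (auto simp: t triples_def)
    from m(4) show ?thesis
    proof
      assume x: "x = c"
      then have "(d, f) \<in> W (time x) \<times> W (time x)" using m by (simp add: W_def)
      then show ?thesis using x by (force simp: t)
    next
      assume x: "x = d"
      then have "(c, f) \<in> W (time x - \<delta>) \<times> W (time x)" using m by (simp add: W_def)
      then show ?thesis using x by (force simp: t)
    qed
  qed
  then have "card {(c, d, f) \<in> triples (set \<tau>) \<delta> i. x \<in> {c, d}} \<le> card (?A \<union> ?B)"
    by (intro card_mono subsetI) (simp_all only: finite_Un finite_imageI finite_cartesian_product W)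
  also have "\<dots> \<le> card ?A + card ?B" by (rule card_Un_le)
  also have "\<dots> \<le> card (W (time x) \<times> W (time x)) + card (W (time x - \<delta>) \<times> W (time x))"
    by (intro add_mono card_image_le) (auto simp: W)
  also have "\<dots> \<le> m_delta \<tau> \<delta> * m_delta \<tau> \<delta> + m_delta \<tau> \<delta> * m_delta \<tau> \<delta>"
    unfolding card_cartesian_product by (intro add_mono mult_mono W) auto
  finally show ?thesis by (simp add: power2_eq_square)
qed

lemma card_overlapping_triples:
  "card {(c, d, f) \<in> triples (set \<tau>) \<delta> i. {a, b} \<inter> {c, d} \<noteq> {}} \<le> 4 * (m_delta \<tau> \<delta>)\<^sup>2"
proof -
  let ?F = "\<lambda>x. {(c, d, f) \<in> triples (set \<tau>) \<delta> i. x \<in> {c, d}}"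
  have "{(c, d, f) \<in> triples (set \<tau>) \<delta> i. {a, b} \<inter> {c, d} \<noteq> {}} = ?F a \<union> ?F b"
    by blast
  then have "card {(c, d, f) \<in> triples (set \<tau>) \<delta> i. {a, b} \<inter> {c, d} \<noteq> {}} \<le>
      card (?F a) + card (?F b)"
    by (simp only: card_Un_le)
  also have "\<dots> \<le> 2 * (m_delta \<tau> \<delta>)\<^sup>2 + 2 * (m_delta \<tau> \<delta>)\<^sup>2"
    by (intro add_mono card_triples_with_edge)
  finally show ?thesis by simp
qed

text \<open>Only the last edge is free, and it lies in the window starting at
  \<open>a\<close>.\<close>

lemma card_triples_with_pair:
  "card {(c, d, f) \<in> triples (set \<tau>) \<delta> i. a = c \<and> b = d} \<le> m_delta \<tau> \<delta>"
proof -
  let ?W = "{e \<in> set \<tau>. time a \<le> time e \<and> time e \<le> time a + \<delta>}"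
  have "t \<in> (\<lambda>f. (a, b, f)) ` ?W"
    if "t \<in> {(c, d, f) \<in> triples (set \<tau>) \<delta> i. a = c \<and> b = d}" for t
  proof -
    obtain c d f where t: "t = (c, d, f)" by (cases t)
    have "f \<in> ?W" "t = (a, b, f)"
      using that is_instance_times[of \<delta> i c d f] by (auto simp: t triples_def)
    then show ?thesis by blast
  qed
  then have "card {(c, d, f) \<in> triples (set \<tau>) \<delta> i. a = c \<and> b = d} \<le>
      card ((\<lambda>f. (a, b, f)) ` ?W)"
    by (intro card_mono subsetI) simp_all
  also have "\<dots> \<le> card ?W" by (intro card_image_le) simp
  also have "\<dots> \<le> m_delta \<tau> \<delta>" by (rule card_window_le)
  finally show ?thesis .
qed

lemma second_moment_le:
  fixes \<tau> :: "'v tedge list" and p \<delta> :: real and i :: nat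
  assumes "0 < p" "p \<le> 1"
  defines "T \<equiv> real (card (triples (set \<tau>) \<delta> i))" and "M \<equiv> real (m_delta \<tau> \<delta>)"
  shows "measure_pmf.expectation (coins (set \<tau>) p)
      (\<lambda>X. ((\<Sum>(a, b, e) \<in> triples (set \<tau>) \<delta> i.
          inv_prob_weight pred p X a * inv_prob_weight pred p X b) - T)\<^sup>2) \<le>
    T * (2 * M * sqrt T / p + M / p\<^sup>2)"
proof -
  let ?T = "triples (set \<tau>) \<delta> i"
  have "real (card {(c, d, f) \<in> ?T. {a, b} \<inter> {c, d} \<noteq> {}}) / p +
      real (card {(c, d, f) \<in> ?T. a = c \<and> b = d}) / p\<^sup>2 \<le> 2 * M * sqrt T / p + M / p\<^sup>2" for a b
  proof -
    let ?N = "real (card {(c, d, f) \<in> ?T. {a, b} \<inter> {c, d} \<noteq> {}})"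
    have "?N \<le> real (4 * (m_delta \<tau> \<delta>)\<^sup>2)"
      unfolding of_nat_le_iff by (rule card_overlapping_triples)
    then have "?N \<le> 4 * M\<^sup>2"
      by (simp only: M_def of_nat_mult of_nat_numeral of_nat_power)
    moreover have "?N \<le> T"
      unfolding T_def of_nat_le_iff by (intro card_mono finite_triples) auto
    \<comment> \<open>A number below two bounds is below their geometric mean, here
      \<open>2 * M * sqrt T\<close>.\<close>
    ultimately have "?N * ?N \<le> (4 * M\<^sup>2) * T"
      by (intro mult_mono) auto
    moreover have "(2 * M * sqrt T)\<^sup>2 = (4 * M\<^sup>2) * T"
      by (simp add: power_mult_distrib T_def)
    ultimately have "?N\<^sup>2 \<le> (2 * M * sqrt T)\<^sup>2"
      by (simp only: power2_eq_square)
    then have "?N \<le> 2 * M * sqrt T"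
      by (rule power2_le_imp_le) (simp add: M_def T_def)
    moreover have "real (card {(c, d, f) \<in> ?T. a = c \<and> b = d}) \<le> M"
      unfolding M_def of_nat_le_iff by (rule card_triples_with_pair)
    ultimately show ?thesis
      using assms(1) by (intro add_mono divide_right_mono) auto
  qed
  then have "(\<Sum>(a, b, e) \<in> ?T. real (card {(c, d, f) \<in> ?T. {a, b} \<inter> {c, d} \<noteq> {}}) / p +
      real (card {(c, d, f) \<in> ?T. a = c \<and> b = d}) / p\<^sup>2) \<le> (\<Sum>t\<in>?T. 2 * M * sqrt T / p + M / p\<^sup>2)"
    by (intro sum_mono) (simp add: case_prod_unfold)
  also have "\<dots> = T * (2 * M * sqrt T / p + M / p\<^sup>2)"
    by (simp add: T_def)
  finally show ?thesis
    unfolding T_def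
    by (rule order_trans[OF second_moment_estimate[OF finite_set assms(1,2)]])
qed

section \<open>Accuracy and memory\<close>

lemma STEP_eq:
  assumes "sorted_wrt (<) (map time \<tau>)"
  shows "STEP \<tau> \<delta> pred p = map_pmf (\<lambda>X. coin_run \<delta> pred X \<tau> init_state) (coins (set \<tau>) p)"
proof -
  have "distinct (map time \<tau>)"
    using assms strict_sorted_iff by blast
  then show ?thesis
    unfolding STEP_def by (intro run_step_eq) (simp add: distinct_map)
qed

text \<open>With \<open>q = T powr (1/4)\<close> and \<open>r = sqrt M\<close> the hypothesis reads
  \<open>9 * r \<le> p * \<epsilon> * q\<close>, and clearing denominators leaves \<open>24 * (2 *
  r\<^sup>2 * q\<^sup>2 * p + r\<^sup>2) \<le> p\<^sup>2 * \<epsilon>\<^sup>2 * q ^ 4\<close>. The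
  exponent 1/4 is what makes \<open>q\<^sup>2\<close> match the factor \<open>sqrt T\<close> of the
  first variance term.\<close>

lemma relative_variance_le:
  fixes T M \<epsilon> p :: real
  assumes "T \<ge> 1" "M \<ge> 1" "\<epsilon> > 0" "0 < p" "p \<le> 1"
    and p: "p \<ge> 9 * sqrt M / (\<epsilon> * T powr (1/4))"
  shows "T * (2 * M * sqrt T / p + M / p\<^sup>2) / (\<epsilon> * T)\<^sup>2 \<le> 1 / 24"
proof -
  define q r where "q = T powr (1/4)" and "r = sqrt M"
  have q: "q \<ge> 1" using assms by (simp add: q_def ge_one_powr_ge_zero)
  have q2: "q\<^sup>2 = sqrt T"
    using assms by (simp add: q_def powr_half_sqrt[symmetric] powr_power)
  then have q4: "q ^ 4 = T"
    using assms by (metis numeral_Bit0 power_add power2_eq_square real_sqrt_mult_self abs_of_nonneg order_trans zero_le_one)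
  have r: "r \<ge> 1" "r\<^sup>2 = M" using assms by (simp_all add: r_def)
  have "\<epsilon> * q > 0" using assms q by simp
  then have 1: "9 * r \<le> p * \<epsilon> * q"
    using p by (simp add: q_def r_def field_simps)
  have "p * (\<epsilon> * q) \<le> 1 * (\<epsilon> * q)" using assms \<open>\<epsilon> * q > 0\<close> by (intro mult_right_mono) auto
  then have 2: "9 * r \<le> \<epsilon> * q" using 1 by simp
  \<comment> \<open>Only one factor \<open>p\<close> is kept here, the other being given up through
    \<open>p \<le> 1\<close>; multiplying by \<open>2 * q\<^sup>2 * p\<close> then produces exactly
    \<open>p\<^sup>2\<close>.\<close>
  have 3: "(9 * r) * (9 * r) \<le> (p * \<epsilon> * q) * (\<epsilon> * q)"
    by (rule mult_mono) (use 1 2 r in linarith)+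
  have 4: "(9 * r) * (9 * r) \<le> (p * \<epsilon> * q) * (p * \<epsilon> * q)"
    by (rule mult_mono) (use 1 r in linarith)+
  have "81 * (2 * r\<^sup>2 * q\<^sup>2 * p) \<le> 2 * (p\<^sup>2 * \<epsilon>\<^sup>2 * q ^ 4)"
    using mult_right_mono[OF 3, of "2 * q\<^sup>2 * p"] assms
    by (simp add: power2_eq_square power4_eq_xxxx algebra_simps)
  moreover have "81 * r\<^sup>2 \<le> p\<^sup>2 * \<epsilon>\<^sup>2 * q ^ 4"
  proof -
    have "(p * \<epsilon> * q)\<^sup>2 * 1 \<le> (p * \<epsilon> * q)\<^sup>2 * q\<^sup>2"
      using q by (intro mult_left_mono) auto
    then show ?thesis using 4 by (simp add: power2_eq_square power4_eq_xxxx algebra_simps)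
  qed
  \<comment> \<open>The two bounds add up to three times the right-hand side, which gives the factor
    81 / 3 = 27; 9 is the least integer whose square reaches 3 * 24.\<close>
  ultimately have "24 * (2 * r\<^sup>2 * q\<^sup>2 * p + r\<^sup>2) \<le> p\<^sup>2 * \<epsilon>\<^sup>2 * q ^ 4"
    using zero_le_mult_iff by (smt (verit) zero_le_power2)
  then have "24 * (2 * M * sqrt T * p + M) \<le> p\<^sup>2 * \<epsilon>\<^sup>2 * T"
    by (simp add: r q2 q4)
  moreover have "T * (2 * M * sqrt T / p + M / p\<^sup>2) / (\<epsilon> * T)\<^sup>2 =
      (2 * M * sqrt T * p + M) / (p\<^sup>2 * \<epsilon>\<^sup>2 * T)"
    using assms by (simp add: field_simps power2_eq_square)
  moreover have "p\<^sup>2 * \<epsilon>\<^sup>2 * T > 0" using assms by simp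
  ultimately show ?thesis by (simp add: field_simps)
qed

text \<open>Chebyshev's inequality for the estimator centred at \<open>T\<close>; the value 1/24 is
  a third divided among eight types.\<close>

lemma STEP_accurate_one:
  fixes \<tau> :: "'v tedge list" and p \<delta> \<epsilon> :: real and i :: nat
  assumes "sorted_wrt (<) (map time \<tau>)" "\<delta> > 0" "\<epsilon> > 0" "0 < p" "p \<le> 1" "i \<in> {1..8}"
  defines "T \<equiv> real (card (instances (set \<tau>) \<delta> i))"
  assumes "T > 0" and p: "p \<ge> 9 * sqrt (m_delta \<tau> \<delta>) / (\<epsilon> * T powr (1/4))"
  shows "measure_pmf.prob (STEP \<tau> \<delta> pred p) {st. \<bar>estimate p st i - T\<bar> \<ge> \<epsilon> * T} \<le> 1 / 24"
proof -
  define f where "f = (\<lambda>X. (\<Sum>(a, b, e) \<in> triples (set \<tau>) \<delta> i.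
          inv_prob_weight pred p X a * inv_prob_weight pred p X b) - T)"
  have T: "T = real (card (triples (set \<tau>) \<delta> i))"
    using card_instances[OF assms(6)] by (simp add: T_def)
  have "T \<ge> 1" using \<open>T > 0\<close> unfolding T by simp
  \<comment> \<open>An instance supplies an edge, hence a nonempty window, and so
    \<open>M \<ge> 1\<close> in the variance bound.\<close>
  have "\<exists>t. t \<in> triples (set \<tau>) \<delta> i" using \<open>T > 0\<close> unfolding T by (metis card.empty ex_in_conv less_irrefl of_nat_0)
  then obtain a where a: "a \<in> set \<tau>" unfolding triples_def by blast
  then have "{a} \<subseteq> {e \<in> set \<tau>. time a \<le> time e \<and> time e \<le> time a + \<delta>}"
    using \<open>\<delta> > 0\<close> by simp
  then have "card {a} \<le> card {e \<in> set \<tau>. time a \<le> time e \<and> time e \<le> time a + \<delta>}"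
    by (intro card_mono) auto
  also have "\<dots> \<le> m_delta \<tau> \<delta>" by (rule card_window_le)
  finally have M: "real (m_delta \<tau> \<delta>) \<ge> 1" by simp
  have "measure_pmf.prob (STEP \<tau> \<delta> pred p) {st. \<bar>estimate p st i - T\<bar> \<ge> \<epsilon> * T} =
      measure_pmf.prob (coins (set \<tau>) p) {X \<in> space (measure_pmf (coins (set \<tau>) p)). \<bar>f X\<bar> \<ge> \<epsilon> * T}"
    using assms(1,2,4) by (simp add: STEP_eq vimage_def estimate_coin_run f_def)
  also have "\<dots> \<le> measure_pmf.expectation (coins (set \<tau>) p) (\<lambda>X. (f X)\<^sup>2) / (\<epsilon> * T)\<^sup>2"
    by (intro measure_pmf.second_moment_method) (use assms in auto)
  also have "\<dots> \<le> T * (2 * real (m_delta \<tau> \<delta>) * sqrt T / p + m_delta \<tau> \<delta> / p\<^sup>2) / (\<epsilon> * T)\<^sup>2"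
    unfolding f_def T by (rule divide_right_mono[OF second_moment_le[OF assms(4,5)]]) simp
  also have "\<dots> \<le> 1 / 24"
    using \<open>T \<ge> 1\<close> M assms by (intro relative_variance_le) auto
  finally show ?thesis .
qed

lemma STEP_accurate:
  fixes \<tau> :: "'v tedge list" and p \<delta> \<epsilon> :: real
  assumes "sorted_wrt (<) (map time \<tau>)" "\<delta> > 0" "\<epsilon> > 0" "0 < p" "p \<le> 1"
  defines "T \<equiv> \<lambda>i. real (card (instances (set \<tau>) \<delta> i))"
  assumes "\<And>i. i \<in> {1..8} \<Longrightarrow> T i > 0"
    and "\<And>i. i \<in> {1..8} \<Longrightarrow> p \<ge> 9 * sqrt (m_delta \<tau> \<delta>) / (\<epsilon> * T i powr (1/4))"
  shows "measure_pmf.prob (STEP \<tau> \<delta> pred p)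
    {st. \<exists>i \<in> {1..8}. \<bar>estimate p st i - T i\<bar> \<ge> \<epsilon> * T i} \<le> 1 / 3"
proof -
  have eq: "{st. \<exists>i \<in> {1..8}. \<bar>estimate p st i - T i\<bar> \<ge> \<epsilon> * T i} =
      (\<Union>i \<in> {1..8}. {st. \<bar>estimate p st i - T i\<bar> \<ge> \<epsilon> * T i})" by blast
  have "measure_pmf.prob (STEP \<tau> \<delta> pred p)
      {st. \<exists>i \<in> {1..8}. \<bar>estimate p st i - T i\<bar> \<ge> \<epsilon> * T i} \<le>
      (\<Sum>i \<in> {1..8}. measure_pmf.prob (STEP \<tau> \<delta> pred p) {st. \<bar>estimate p st i - T i\<bar> \<ge> \<epsilon> * T i})"
    unfolding eq by (rule measure_pmf.finite_measure_subadditive_finite) simp_all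
  also have "\<dots> \<le> (\<Sum>i \<in> {1..8::nat}. 1 / 24)"
    unfolding T_def by (intro sum_mono STEP_accurate_one) (use assms in auto)
  finally show ?thesis by simp
qed

section \<open>Expected number of stored edges\<close>

text \<open>Meant for a prefix \<open>es\<close> of the stream. The stored light edges are among
  those with a successful coin in the closed window ending at the last edge, and each coin has mean
  \<open>p\<close>. Coins of heavy edges in the window are counted as well, which only increases the
  bound.\<close>

lemma expected_stored_le:
  fixes p :: real
  assumes "sorted_wrt (<) (map time es)" "set es \<subseteq> set \<tau>" "\<delta> > 0" "0 < p" "p \<le> 1"
  shows "measure_pmf.expectation (STEP es \<delta> pred p) (\<lambda>st. real (card (heavy st \<union> light st)))
    \<le> real (card {e \<in> set \<tau>. pred e}) + m_delta \<tau> \<delta> * p"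
proof -
  define H where "H = {e \<in> set \<tau>. pred e}"
  define R where "R = {e \<in> set es. time (last es) - \<delta> \<le> time e}"
  have last: "time e \<le> time (last es)" if "e \<in> set es" for e
    using assms(1) that by (cases es rule: rev_cases) (auto simp: sorted_wrt_append)
  let ?run = "\<lambda>X. coin_run \<delta> pred X es init_state"
  have le: "real (card (heavy (?run X) \<union> light (?run X))) \<le> real (card H) + (\<Sum>e\<in>R. of_bool (X e))" for X
  proof -
    have "card (heavy (?run X) \<union> light (?run X)) \<le> card (H \<union> {e \<in> R. X e})"
      using assms(2) unfolding coin_run_eq[OF assms(1,3)]
      by (intro card_mono) (auto simp: H_def R_def)
    also have "\<dots> \<le> card H + card {e \<in> R. X e}" by (rule card_Un_le)
    finally have "real (card (heavy (?run X) \<union> light (?run X))) \<le> real (card H) + real (card {e \<in> R. X e})"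
      by linarith
    also have "real (card {e \<in> R. X e}) = (\<Sum>e\<in>R. of_bool (X e))"
      by (simp add: R_def Int_def)
    finally show ?thesis .
  qed
  have coin: "measure_pmf.expectation (coins (set es) p) (\<lambda>X. of_bool (X e)) = p" if "e \<in> R" for e
  proof -
    have "measure_pmf.expectation (coins (set es) p) (\<lambda>X. of_bool (X e)) =
        measure_pmf.expectation (map_pmf (\<lambda>X. X e) (coins (set es) p)) (of_bool :: bool \<Rightarrow> real)"
      by simp
    also have "map_pmf (\<lambda>X. X e) (coins (set es) p) = bernoulli_pmf p"
      using that by (simp add: Pi_pmf_component R_def)
    finally show ?thesis using assms by simp
  qed
  have "measure_pmf.expectation (STEP es \<delta> pred p) (\<lambda>st. real (card (heavy st \<union> light st))) =
      measure_pmf.expectation (coins (set es) p) (\<lambda>X. real (card (heavy (?run X) \<union> light (?run X))))"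
    by (simp add: STEP_eq[OF assms(1)])
  also have "\<dots> \<le> measure_pmf.expectation (coins (set es) p) (\<lambda>X. real (card H) + (\<Sum>e\<in>R. of_bool (X e)))"
    by (intro integral_mono le) simp_all
  also have "\<dots> = real (card H) + real (card R) * p"
    by (simp add: Bochner_Integration.integral_sum coin)
  also have "card R \<le> m_delta \<tau> \<delta>"
  proof -
    have "card R \<le> card {e \<in> set \<tau>. time (last es) - \<delta> \<le> time e \<and> time e \<le> (time (last es) - \<delta>) + \<delta>}"
      by (intro card_mono) (use last assms(2) in \<open>auto simp: R_def\<close>)
    then show ?thesis using card_window_le order_trans by blast
  qed
  then have "real (card H) + real (card R) * p \<le> real (card H) + m_delta \<tau> \<delta> * p"
    using assms by (intro add_left_mono mult_right_mono) auto
  finally show ?thesis by (simp add: H_def)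
qed

lemma card_heavy_le:
  assumes "ranking_predictor E \<delta> K pred"
  shows "card {e \<in> E. pred e} \<le> K"
proof -
  obtain es where "\<forall>e \<in> E. pred e \<longleftrightarrow> e \<in> set (take K es)"
    using assms unfolding ranking_predictor_def by blast
  then have "card {e \<in> E. pred e} \<le> card (set (take K es))"
    by (intro card_mono) auto
  also have "\<dots> \<le> K" using card_length[of "take K es"] by simp
  finally show ?thesis .
qed

lemma expected_memory_le:
  fixes p :: real
  assumes "sorted_wrt (<) (map time \<tau>)" "\<delta> > 0" "0 < p" "p \<le> 1"
    and "ranking_predictor (set \<tau>) \<delta> K pred"
  shows "expected_memory \<tau> \<delta> pred p \<le> real K + m_delta \<tau> \<delta> * p"
  unfolding expected_memory_def
proof (rule Max.boundedI)
  fix x assume "x \<in> (\<lambda>k. measure_pmf.expectation (STEP (take k \<tau>) \<delta> pred p)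
      (\<lambda>st. real (card (heavy st \<union> light st)))) ` {..length \<tau>}"
  then obtain k where x: "x = measure_pmf.expectation (STEP (take k \<tau>) \<delta> pred p)
      (\<lambda>st. real (card (heavy st \<union> light st)))" by blast
  have "x \<le> real (card {e \<in> set \<tau>. pred e}) + m_delta \<tau> \<delta> * p"
    unfolding x using assms
    by (intro expected_stored_le) (auto simp: take_map[symmetric] sorted_wrt_take dest: in_set_takeD)
  also have "\<dots> \<le> real K + m_delta \<tau> \<delta> * p"
    using card_heavy_le[OF assms(5)] by simp
  finally show "x \<le> real K + m_delta \<tau> \<delta> * p" .
qed auto

lemma expected_memory_nonneg: "expected_memory \<tau> \<delta> pred p \<ge> 0"
proof -
  have "0 \<le> measure_pmf.expectation (STEP (take 0 \<tau>) \<delta> pred p) (\<lambda>st. real (card (heavy st \<union> light st)))"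
    by (intro Bochner_Integration.integral_nonneg) simp
  also have "\<dots> \<le> expected_memory \<tau> \<delta> pred p"
    unfolding expected_memory_def by (intro Max_ge) blast+
  finally show ?thesis .
qed

section \<open>Asymptotic form and conclusion\<close>

text \<open>The memory bound is, up to a constant factor, \<open>M\<close> times the threshold on
  \<open>p\<close>. So \<open>p\<close> of the order of the threshold turns the light part
  \<open>M n * p n\<close> into the bound.\<close>

lemma memory_bigo:
  fixes K :: "nat \<Rightarrow> nat" and p mem bound threshold M :: "nat \<Rightarrow> real"
  assumes "\<And>n. 0 \<le> mem n" "\<And>n. mem n \<le> real (K n) + M n * p n"
    and M: "\<And>n. M n * threshold n = c * bound n" and "\<And>n. 0 \<le> bound n" and p: "p \<in> O(threshold)"
  shows "mem \<in> O(\<lambda>n. real (K n) + bound n)"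
proof -
  have "(\<lambda>n. M n * p n) \<in> O(\<lambda>n. M n * threshold n)"
    using p by (intro landau_o.big.mult_left) 
  also have "(\<lambda>n. M n * threshold n) \<in> O(bound)"
    unfolding M by (cases "c = 0") auto
  also have "bound \<in> O(\<lambda>n. real (K n) + bound n)"
    using assms(4) by (intro bigoI[of _ 1]) auto
  finally have "(\<lambda>n. M n * p n) \<in> O(\<lambda>n. real (K n) + bound n)" .
  moreover have "(\<lambda>n. real (K n)) \<in> O(\<lambda>n. real (K n) + bound n)"
    using assms(4) by (intro bigoI[of _ 1]) auto
  ultimately have "(\<lambda>n. real (K n) + M n * p n) \<in> O(\<lambda>n. real (K n) + bound n)"
    by (intro sum_in_bigo)
  moreover have "mem \<in> O(\<lambda>n. real (K n) + M n * p n)"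
    using assms(1,2) by (intro bigoI[of _ 1] always_eventually) (auto intro: order_trans[OF _ abs_ge_self])
  ultimately show ?thesis using landau_o.big_trans by blast
qed

text \<open>The asymptotic notation refers to an arbitrary sequence of inputs indexed by
  \<open>n\<close>, along which \<epsilon> and \<open>p\<close> may vary, while \<open>C\<close> and
  \<gamma> are fixed beforehand. The memory claim takes \<open>p\<close> of the order of the
  threshold, since a larger \<open>p\<close> stores more edges. The heavy edges enter as the summand
  \<open>K\<close>, absorbed whenever it is of the order of the bound.\<close>

theorem theorem1:
  shows "\<exists>C > 1. \<exists>\<gamma> \<in> {0 <..< 1/2}.
    \<forall>(V :: nat \<Rightarrow> 'v set) (E :: nat \<Rightarrow> 'v tedge set) (\<tau> :: nat \<Rightarrow> 'v tedge list)
      (\<delta> :: nat \<Rightarrow> real) (C\<^sub>0 :: real) (K :: nat \<Rightarrow> nat) (pred :: nat \<Rightarrow> 'v tedge \<Rightarrow> bool)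
      (\<epsilon> :: nat \<Rightarrow> real) (p :: nat \<Rightarrow> real).
    (let T = (\<lambda>i n. real (card (instances (E n) (\<delta> n) i)));
         m\<delta> = (\<lambda>n. real (m_delta (\<tau> n) (\<delta> n)));
         threshold = (\<lambda>i n. C * sqrt (m\<delta> n) / (\<epsilon> n * T i n powr (1/2 - \<gamma>)));
         bound = (\<lambda>i n. inverse (\<epsilon> n) * m\<delta> n powr (3/2) / T i n powr (1/2 - \<gamma>));
         memory = (\<lambda>n. expected_memory (\<tau> n) (\<delta> n) (pred n) (p n))
     in
      (\<forall>n. temporal_graph (V n) (E n) \<and> stream_of (\<tau> n) (E n) \<and> \<delta> n > 0 \<and> \<epsilon> n > 0 \<and>
           0 < p n \<and> p n \<le> 1 \<and> ranking_predictor (E n) (\<delta> n) (K n) (pred n)) \<longrightarrow>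
      (\<forall>n. \<forall>i \<in> {1..8}. \<forall>j \<in> {1..8}. T i n = C\<^sub>0 * T j n) \<longrightarrow>
      (\<forall>n. \<forall>i \<in> {1..8}. T i n > 0) \<longrightarrow>
      (\<lambda>n. real (K n)) \<in> o(m\<delta>) \<longrightarrow>
      (\<forall>n. \<forall>i \<in> {1..8}. p n \<ge> threshold i n) \<longrightarrow>
        (\<forall>n. measure_pmf.prob (STEP (\<tau> n) (\<delta> n) (pred n) (p n))
               {st. \<exists>i \<in> {1..8}. \<bar>estimate (p n) st i - T i n\<bar> \<ge> \<epsilon> n * T i n} \<le> 1/3) \<and>
        (\<forall>i \<in> {1..8}. p \<in> O(threshold i) \<longrightarrow>
           memory \<in> O(\<lambda>n. real (K n) + bound i n) \<and>
           ((\<lambda>n. real (K n)) \<in> O(bound i) \<longrightarrow> memory \<in> O(bound i))))"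
proof -
  have main: "(\<forall>n. measure_pmf.prob (STEP (\<tau> n) (\<delta> n) (pred n) (p n))
               {st. \<exists>i \<in> {1..8}. \<bar>estimate (p n) st i - T i n\<bar> \<ge> \<epsilon> n * T i n} \<le> 1/3) \<and>
        (\<forall>i \<in> {1..8}. p \<in> O(threshold i) \<longrightarrow>
           memory \<in> O(\<lambda>n. real (K n) + bound i n) \<and>
           ((\<lambda>n. real (K n)) \<in> O(bound i) \<longrightarrow> memory \<in> O(bound i)))"
    if T: "T = (\<lambda>i n. real (card (instances (E n) (\<delta> n) i)))"
      and m: "m\<delta> = (\<lambda>n. real (m_delta (\<tau> n) (\<delta> n)))"
      and th: "threshold = (\<lambda>i n. 9 * sqrt (m\<delta> n) / (\<epsilon> n * T i n powr (1/2 - 1/4)))"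
      and bd: "bound = (\<lambda>i n. inverse (\<epsilon> n) * m\<delta> n powr (3/2) / T i n powr (1/2 - 1/4))"
      and mem: "memory = (\<lambda>n. expected_memory (\<tau> n) (\<delta> n) (pred n) (p n))"
      and inst: "\<forall>n. temporal_graph (V n) (E n) \<and> stream_of (\<tau> n) (E n) \<and> \<delta> n > 0 \<and> \<epsilon> n > 0 \<and>
           0 < p n \<and> p n \<le> 1 \<and> ranking_predictor (E n) (\<delta> n) (K n) (pred n)"
      and pos: "\<forall>n. \<forall>i \<in> {1..8}. T i n > 0"
      and p: "\<forall>n. \<forall>i \<in> {1..8}. p n \<ge> threshold i n"
    for V :: "nat \<Rightarrow> 'v set" and E :: "nat \<Rightarrow> 'v tedge set" and \<tau> \<delta> K pred \<epsilon> p T m\<delta> threshold bound memory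
  proof (intro conjI allI ballI impI)
    have E: "E n = set (\<tau> n)" and sorted: "sorted_wrt (<) (map time (\<tau> n))" for n
      using inst by (auto simp: stream_of_def)
    show "measure_pmf.prob (STEP (\<tau> n) (\<delta> n) (pred n) (p n))
        {st. \<exists>i \<in> {1..8}. \<bar>estimate (p n) st i - T i n\<bar> \<ge> \<epsilon> n * T i n} \<le> 1/3" for n
      using inst pos p unfolding T E th m by (intro STEP_accurate sorted) auto
    fix i :: nat assume i: "p \<in> O(threshold i)"
    \<comment> \<open>The window size times the square root in the threshold produces the exponent
      3/2 of the memory bound.\<close>
    have "m\<delta> n * threshold i n = 9 * bound i n" for n
    proof -
      have "m\<delta> n * sqrt (m\<delta> n) = m\<delta> n powr (1 + 1/2)"
        by (subst powr_add) (simp add: m powr_half_sqrt)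
      then show ?thesis by (simp add: th bd field_simps)
    qed
    moreover have "0 \<le> memory n" for n
      unfolding mem by (rule expected_memory_nonneg)
    moreover have "memory n \<le> real (K n) + m\<delta> n * p n" for n
      using inst unfolding mem m E by (intro expected_memory_le sorted) blast+
    moreover have "0 \<le> bound i n" for n
      using inst by (simp add: bd less_imp_le)
    ultimately show 1: "memory \<in> O(\<lambda>n. real (K n) + bound i n)"
      using i by (intro memory_bigo)
    assume "(\<lambda>n. real (K n)) \<in> O(bound i)"
    then have "(\<lambda>n. real (K n) + bound i n) \<in> O(bound i)"
      by (intro sum_in_bigo) auto
    with 1 show "memory \<in> O(bound i)" by (rule landau_o.big_trans)
  qed
  show ?thesis
  \<comment> \<open>Both witnesses come from \<open>relative_variance_le\<close>, whose exponent 1/4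
    is 1/2 - \<gamma>.\<close>
  proof (rule exI[of _ 9], intro conjI bexI[of _ "1/4"] allI, goal_cases)
    case (2 V E \<tau> \<delta> C\<^sub>0 K pred \<epsilon> p)
    note main = main[where V = V and E = E and \<tau> = \<tau> and \<delta> = \<delta> and K = K and pred = pred
        and \<epsilon> = \<epsilon> and p = p, OF refl refl refl refl refl]
    show ?case
      unfolding Let_def by (intro impI) (rule main; assumption)
  qed auto
qed

end
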